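(* For every $n\ge 1$ there exists a reduced equilibrium in $G_n(\mu)$, i.e. a Nash equilibrium $(\Pi_n,X_n)$ of the reduced game $\overline{G}_n(\mu)$.
   Context: Standing assumptions. (A1) $\mu$ is a probability measure on $[0,1]$, absolutely continuous with respect to Lebesgue measure, with strictly positive $C^1$ density $f_\mu$ on $[0,1]$. (A2) $H:\mathbb{R}\to\mathbb{R}$ is strictly increasing, strictly convex and $C^2$, $H'$ is Lipschitz-continuous, and there are constants $\epsilon,K>0$ with $\epsilon<H'(x)<K$ for all $x\in\mathbb{R}$. Notation. $\Omega_n=\{-1,+1\}^n$, $\omega=(u_1,\dots,u_n)\in\Omega_n$; $S_n(\omega)=\frac{1}{\sqrt n}\sum_{q=1}^n u_q$. The game $G_n(\mu)$: nature draws $L\sim\mu$, observed only by player 1. At each stage $q=1,\dots,n$, simultaneously player 1 chooses $u_q\in\{-1,+1\}$ and player 2 chooses a price $p_q\in\mathbb{R}$; both are then publicly revealed. Player 1 maximizes $E[\frac{1}{\sqrt n}\sum_q u_q(L-p_q)]$ and player 2 minimizes $E[H(\frac{1}{\sqrt n}\sum_q u_q(L-p_q))]$. The reduced game $\overline{G}_n(\mu)$ is the same game except that player 1 does not observe player 2's actions and player 2 is restricted to pure strategies. Equilibria of $\overline{G}_n(\mu)$ are called reduced equilibria of $G_n(\mu)$. In $\overline{G}_n(\mu)$ a strategy of player 1 is identified with a probability $\Pi$ on pairs $(\omega,L)\in\Omega_n\times\mathbb{R}$ whose marginal on $L$ is $\mu$. A (pure) strategy of player 2 is a sequence $\overline p=(\overline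 p_1,\dots,\overline p_n)$ with $\overline p_q:\{-1,+1\}^{q-1}\to\mathbb{R}$; it is identified with the function $X_{n,\overline p}(\omega)=\frac{1}{\sqrt n}\sum_{q=1}^n u_q\,\overline p_q(u_1,\dots,u_{q-1})$. $\mathbb{X}_n$ denotes the set of all such functions. Payoffs: $g_1(\Pi,X)=E_\Pi[LS_n-X]$ (maximized by player 1) and $g_2(\Pi,X)=E_\Pi[H(LS_n-X)]$ (minimized by player 2). A Nash equilibrium is a pair $(\Pi,X)$ such that $\Pi$ maximizes $g_1(\cdot,X)$ over player 1's strategies and $X$ minimizes $g_2(\Pi,\cdot)$ over $\mathbb{X}_n$. *)

theory Defs
  imports "HOL-Probability.Probability"
begin

section \<open>Standing assumptions\<close>

text \<open>The law of the liquidation value is a Borel measure on the whole real line carried by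
  \<open>[0,1]\<close>. The derivative of the density at the end points is one-sided.\<close>

definition admissible_prior :: "real measure \<Rightarrow> bool" where
  "admissible_prior \<mu> \<longleftrightarrow>
     prob_space \<mu> \<and>
     (\<exists>f f'. \<mu> = density lborel (\<lambda>x. ennreal (f x * indicator {0..1} x)) \<and>
        (\<forall>x\<in>{0..1}. 0 < f x) \<and>
        (\<forall>x\<in>{0..1}. (f has_real_derivative f' x) (at x within {0..1})) \<and>
        continuous_on {0..1} f')"

definition strictly_convex :: "(real \<Rightarrow> real) \<Rightarrow> bool" where
  "strictly_convex H \<longleftrightarrow>
     (\<forall>x y t. x \<noteq> y \<longrightarrow> 0 < t \<longrightarrow> t < 1 \<longrightarrow>
        H ((1 - t) * x + t * y) < (1 - t) * H x + t * H y)"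

definition admissible_risk :: "(real \<Rightarrow> real) \<Rightarrow> bool" where
  "admissible_risk H \<longleftrightarrow>
     strict_mono H \<and> strictly_convex H \<and>
     (\<exists>H' H''.
        (\<forall>x. (H has_real_derivative H' x) (at x)) \<and>
        (\<forall>x. (H' has_real_derivative H'' x) (at x)) \<and>
        continuous_on UNIV H'' \<and>
        (\<exists>C. C-lipschitz_on UNIV H') \<and>
        (\<exists>\<epsilon> K. 0 < \<epsilon> \<and> 0 < K \<and> (\<forall>x. \<epsilon> < H' x \<and> H' x < K)))"

section \<open>The reduced game\<close>

definition Omega :: "nat \<Rightarrow> (nat \<Rightarrow> real) set" where
  "Omega n = {1..n} \<rightarrow>\<^sub>E {-1, 1}"

definition Sn :: "nat \<Rightarrow> (nat \<Rightarrow> real) \<Rightarrow> real" where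
  "Sn n \<omega> = (1 / sqrt (real n)) * (\<Sum>q=1..n. \<omega> q)"

text \<open>\<open>p q\<close> is the price posted at stage \<open>q\<close>; its argument is the history
  \<open>(u\<^sub>1, \<dots>, u\<^sub>q\<^sub>-\<^sub>1)\<close>, that is, the restriction of \<open>\<omega>\<close> to \<open>{1..<q}\<close>. Values of \<open>p q\<close> at
  arguments that are not such histories are irrelevant.\<close>

definition price_fun ::
    "nat \<Rightarrow> (nat \<Rightarrow> (nat \<Rightarrow> real) \<Rightarrow> real) \<Rightarrow> (nat \<Rightarrow> real) \<Rightarrow> real" where
  "price_fun n p =
     (\<lambda>\<omega>\<in>Omega n. (1 / sqrt (real n)) * (\<Sum>q=1..n. \<omega> q * p q (restrict \<omega> {1..<q})))"

definition strategies1 :: "nat \<Rightarrow> real measure \<Rightarrow> ((nat \<Rightarrow> real) \<times> real) measure set" where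
  "strategies1 n \<mu> =
     {P. prob_space P \<and> sets P = sets (count_space (Omega n) \<Otimes>\<^sub>M borel) \<and>
         distr P borel snd = \<mu>}"

definition strategies2 :: "nat \<Rightarrow> ((nat \<Rightarrow> real) \<Rightarrow> real) set" where
  "strategies2 n = range (price_fun n)"

text \<open>Under a strategy of player 1 for a prior carried by \<open>[0,1]\<close>, the integrands of both payoffs
  are almost surely bounded (for continuous \<open>H\<close>), so these integrals are genuine expectations.\<close>

definition g1 ::
    "nat \<Rightarrow> ((nat \<Rightarrow> real) \<times> real) measure \<Rightarrow> ((nat \<Rightarrow> real) \<Rightarrow> real) \<Rightarrow> real" where
  "g1 n P X = (LINT (\<omega>, l)|P. l * Sn n \<omega> - X \<omega>)"

definition g2 ::
    "nat \<Rightarrow> (real \<Rightarrow> real) \<Rightarrow> ((nat \<Rightarrow> real) \<times> real) measure \<Rightarrow> ((nat \<Rightarrow> real) \<Rightarrow> real) \<Rightarrow> real" where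
  "g2 n H P X = (LINT (\<omega>, l)|P. H (l * Sn n \<omega> - X \<omega>))"

definition reduced_equilibrium ::
    "nat \<Rightarrow> real measure \<Rightarrow> (real \<Rightarrow> real) \<Rightarrow>
     ((nat \<Rightarrow> real) \<times> real) measure \<Rightarrow> ((nat \<Rightarrow> real) \<Rightarrow> real) \<Rightarrow> bool" where
  "reduced_equilibrium n \<mu> H P X \<longleftrightarrow>
     P \<in> strategies1 n \<mu> \<and> X \<in> strategies2 n \<and>
     (\<forall>P'\<in>strategies1 n \<mu>. g1 n P' X \<le> g1 n P X) \<and>
     (\<forall>X'\<in>strategies2 n. g2 n H P X \<le> g2 n H P X')"

end

theory Submission
  imports Defs
begin

text \<open>The proof constructs a symmetric equilibrium explicitly, up to two real parameters that are found by
the intermediate value theorem.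

A function on \<open>Omega n\<close> is a strategy of player 2 exactly if its values sum to zero: prices
can represent any such function, by predictable representation on the binary tree
(\<open>mean_zero_in_strategies2\<close>), and flipping the sign of a single move shows that they represent
no other (\<open>sum_price_fun\<close>). Hence player 2's problem is the minimisation of a convex function
on a hyperplane, and \<open>X\<close> is optimal as soon as the marginal risks
\<open>E[H'(L S - X); \<omega>]\<close> take the same value \<open>\<nu>\<close> for all \<open>\<omega>\<close>
(\<open>g2_minimal_if_equalized\<close>).

Look for \<open>X \<omega> = \<psi> k\<close> depending only on the number \<open>k\<close> of moves
\<open>+1\<close> in \<open>\<omega>\<close>, so that \<open>S\<close> takes the value \<open>s k = (2 k - n) / sqrt n\<close>.
Player 1 then faces the lines \<open>l \<mapsto> l * s k - \<psi> k\<close>. The slopes increase with constant gap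
\<open>\<delta> = 2 / sqrt n\<close>, and consecutive lines cross at \<open>a (Suc k)\<close> if
\<open>\<psi> (Suc k) = \<psi> k + \<delta> * a (Suc k)\<close>. When these crossing points increase, line
\<open>k\<close> attains the upper envelope on the cell \<open>[a k, a (Suc k)]\<close>, and it is a best reply to
play, for \<open>L\<close> in that cell, a uniformly random \<open>\<omega>\<close> with \<open>k\<close> moves \<open>+1\<close>.

What is left is a finite system for the knots \<open>a\<close> and the levels \<open>\<psi>\<close>: the first knot is 0,
the last is 1, the integral of \<open>H'(l * s k - \<psi> k)\<close> against the prior over cell \<open>k\<close> equals
\<open>\<nu>\<close> times the number \<open>c k\<close> of the corresponding \<open>\<omega>\<close>, and
\<open>\<Sum>k. c k * \<psi> k = 0\<close>. It is solved by shooting (\<open>exists_balanced_cells\<close>). The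
parameters \<open>\<psi> 0\<close> and \<open>\<nu>\<close> determine all cells one after the other. Since \<open>H'\<close>
is nondecreasing, every knot and every level is nondecreasing in \<open>\<psi> 0\<close>; therefore each
\<open>\<nu> \<ge> 0\<close> has exactly one \<open>\<psi> 0\<close> for which the levels have mean zero, and it depends
continuously on \<open>\<nu>\<close>. Along this curve the last knot moves continuously from 0 to at least 1.\<close>

section \<open>Cells of prescribed weight by shooting\<close>

text \<open>An implicit function theorem by monotonicity: if \<open>y < \<beta> t\<close>, then \<open>G t y < 0\<close>, which
persists for parameters near \<open>t\<close> and keeps their zeros above \<open>y\<close>; likewise from above.\<close>
lemma continuous_on_implicit_zero:
  fixes G :: "'a::topological_space \<Rightarrow> real \<Rightarrow> real"
  assumes cont: "\<And>b. continuous_on S (\<lambda>t. G t b)"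
    and mono: "\<And>t. t \<in> S \<Longrightarrow> strict_mono (G t)"
    and zero: "\<And>t. t \<in> S \<Longrightarrow> G t (\<beta> t) = 0"
  shows "continuous_on S \<beta>"
  unfolding continuous_on_def
proof (intro ballI order_tendstoI)
  fix t y
  assume t: "t \<in> S"
  note lim = cont[unfolded continuous_on_def, rule_format, OF t]
  { assume "y < \<beta> t"
    then have "G t y < 0"
      using strict_monoD[OF mono[OF t]] zero[OF t] by fastforce
    then have "\<forall>\<^sub>F t' in at t within S. G t' y < 0"
      using order_tendstoD(2)[OF lim] by blast
    moreover have "\<forall>\<^sub>F t' in at t within S. t' \<in> S"
      by (simp add: eventually_at_filter)
    ultimately show "\<forall>\<^sub>F t' in at t within S. y < \<beta> t'"
      by eventually_elim (metis mono strict_mono_less zero) }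
  { assume "\<beta> t < y"
    then have "0 < G t y"
      using strict_monoD[OF mono[OF t]] zero[OF t] by fastforce
    then have "\<forall>\<^sub>F t' in at t within S. 0 < G t' y"
      using order_tendstoD(1)[OF lim] by blast
    moreover have "\<forall>\<^sub>F t' in at t within S. t' \<in> S"
      by (simp add: eventually_at_filter)
    ultimately show "\<forall>\<^sub>F t' in at t within S. \<beta> t' < y"
      by eventually_elim (metis mono strict_mono_less zero) }
qed

text \<open>The integrand \<open>h k x\<close> weighs the points of the \<open>k\<close>-th cell when its level is \<open>x\<close>. It lives
on the whole real line, with bounds \<open>\<alpha>\<close> and \<open>\<beta>\<close> valid everywhere, so that a cell of
any given weight exists to the right of any starting point, even beyond the support of the prior.\<close>
locale cell_weights =
  fixes h :: "nat \<Rightarrow> real \<Rightarrow> real \<Rightarrow> real" and \<alpha> \<beta> D :: real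
    and c :: "nat \<Rightarrow> real" and \<delta> :: real
  assumes h_cont: "continuous_on UNIV (h k x)"
    and \<alpha>_pos: "0 < \<alpha>"
    and h_lower: "\<alpha> \<le> h k x l"
    and h_upper: "h k x l \<le> \<beta>"
    and h_anti: "x \<le> y \<Longrightarrow> h k y l \<le> h k x l"
    and h_lipschitz: "\<bar>h k x l - h k y l\<bar> \<le> D * \<bar>x - y\<bar>"
    and c_nonneg: "0 \<le> c k"
    and \<delta>_nonneg: "0 \<le> \<delta>"
begin

text \<open>\<open>W k x b\<close> is the oriented integral of \<open>h k x\<close> from \<open>0\<close> to \<open>b\<close>, encoded as an
antiderivative so that estimates on increments reduce to the mean value theorem.\<close>
definition W :: "nat \<Rightarrow> real \<Rightarrow> real \<Rightarrow> real" where
  "W k x = (SOME F. F 0 = 0 \<and> (\<forall>l. (F has_real_derivative h k x l) (at l)))"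

lemma W_zero: "W k x 0 = 0"
  and W_deriv: "(W k x has_real_derivative h k x l) (at l)"
proof -
  have "\<exists>F. \<forall>l::real. (F has_vector_derivative h k x l) (at l)"
    using einterval_antiderivative[of "-\<infinity>" "\<infinity>" "h k x"] h_cont
    by (auto simp: continuous_on_eq_continuous_at)
  then obtain F where F: "\<And>l. (F has_real_derivative h k x l) (at l)"
    by (auto simp: has_real_derivative_iff_has_vector_derivative)
  have "((\<lambda>l. F l - F 0) has_real_derivative h k x l) (at l)" for l
    using F by (auto intro!: derivative_eq_intros)
  then have "\<exists>F. F 0 = 0 \<and> (\<forall>l. (F has_real_derivative h k x l) (at l))"
    by (intro exI[of _ "\<lambda>l. F l - F 0"]) auto
  from someI_ex[OF this] show "W k x 0 = 0" "(W k x has_real_derivative h k x l) (at l)"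
    by (auto simp: W_def)
qed

lemma W_increment_lower: "\<alpha> * (b - a) \<le> W k x b - W k x a"
  and W_increment_upper: "W k x b - W k x a \<le> \<beta> * (b - a)" if "a \<le> b"
proof -
  have "W k x a - \<alpha> * a \<le> W k x b - \<alpha> * b"
    by (rule DERIV_nonneg_imp_nondecreasing[OF that])
       (auto intro!: derivative_eq_intros W_deriv exI simp: h_lower)
  then show "\<alpha> * (b - a) \<le> W k x b - W k x a" by (simp add: algebra_simps)
  have "\<beta> * a - W k x a \<le> \<beta> * b - W k x b"
    by (rule DERIV_nonneg_imp_nondecreasing[OF that])
       (auto intro!: derivative_eq_intros W_deriv exI simp: h_upper)
  then show "W k x b - W k x a \<le> \<beta> * (b - a)" by (simp add: algebra_simps)
qed

lemma W_increment_anti: "W k y b - W k y a \<le> W k x b - W k x a" if "a \<le> b" "x \<le> y"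
proof -
  have "W k x a - W k y a \<le> W k x b - W k y b"
    by (rule DERIV_nonneg_imp_nondecreasing[OF that(1)])
       (use h_anti[OF that(2)] in \<open>auto intro!: derivative_eq_intros W_deriv exI\<close>)
  then show ?thesis by simp
qed

lemma W_strict_mono: "strict_mono (W k x)"
proof (rule strict_monoI)
  fix a b :: real assume "a < b"
  then have "0 < \<alpha> * (b - a)" using \<alpha>_pos by simp
  also have "\<dots> \<le> W k x b - W k x a" using \<open>a < b\<close> by (intro W_increment_lower) simp
  finally show "W k x a < W k x b" by simp
qed

lemma isCont_W: "isCont (W k x) l"
  using W_deriv by (rule DERIV_isCont)

lemma W_lipschitz: "\<bar>W k x b - W k y b\<bar> \<le> D * \<bar>x - y\<bar> * \<bar>b\<bar>"
proof -
  have "norm ((\<lambda>l. W k x l - W k y l) b - (\<lambda>l. W k x l - W k y l) 0) \<le> D * \<bar>x - y\<bar> * norm (b - 0)"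
    by (rule field_differentiable_bound[where S = UNIV])
       (auto intro!: derivative_eq_intros W_deriv simp: h_lipschitz)
  then show ?thesis by (simp add: W_zero)
qed

text \<open>Joint continuity: \<open>W\<close> is continuous in its end point, and Lipschitz in the level with a constant
that is locally bounded in the end point.\<close>
lemma tendsto_W:
  assumes "(f \<longlongrightarrow> x) F" "(g \<longlongrightarrow> b) F"
  shows "((\<lambda>t. W k (f t) (g t)) \<longlongrightarrow> W k x b) F"
proof -
  have "((\<lambda>t. D * \<bar>f t - x\<bar> * \<bar>g t\<bar>) \<longlongrightarrow> D * \<bar>x - x\<bar> * \<bar>b\<bar>) F"
    by (intro tendsto_intros assms)
  then have "((\<lambda>t. D * \<bar>f t - x\<bar> * \<bar>g t\<bar>) \<longlongrightarrow> 0) F" by simp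
  then have "((\<lambda>t. W k (f t) (g t) - W k x (g t)) \<longlongrightarrow> 0) F"
    by (rule Lim_null_comparison[rotated]) (simp add: W_lipschitz)
  moreover have "((\<lambda>t. W k x (g t)) \<longlongrightarrow> W k x b) F"
    by (rule isCont_tendsto_compose[OF isCont_W assms(2)])
  ultimately show ?thesis using tendsto_add by fastforce
qed

lemma continuous_on_W [continuous_intros]:
  "continuous_on S f \<Longrightarrow> continuous_on S g \<Longrightarrow> continuous_on S (\<lambda>t. W k (f t) (g t))"
  by (auto simp: continuous_on_def intro: tendsto_W)

text \<open>The end point of the cell that starts at \<open>a\<close> and has weight \<open>y\<close>.\<close>
definition step :: "nat \<Rightarrow> real \<Rightarrow> real \<Rightarrow> real \<Rightarrow> real" where
  "step k x a y = (SOME b. W k x b = W k x a + y)"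

lemma W_step: "W k x (step k x a y) = W k x a + y"
proof -
  define r where "r = \<bar>y\<bar> / \<alpha>"
  have r: "r \<ge> 0" "\<alpha> * r = \<bar>y\<bar>" using \<alpha>_pos by (auto simp: r_def)
  have "W k x (a - r) \<le> W k x a + y" "W k x a + y \<le> W k x (a + r)"
    using W_increment_lower[of "a - r" a k x] W_increment_lower[of a "a + r" k x] r by auto
  then have "\<exists>b. a - r \<le> b \<and> b \<le> a + r \<and> W k x b = W k x a + y"
    by (intro IVT') (auto intro!: continuous_at_imp_continuous_on isCont_W r(1) add_increasing2
       order_trans[of "a - r" a "a + r"])
  then show ?thesis unfolding step_def by (metis (mono_tags, lifting) someI)
qed

lemma step_ge: "0 \<le> y \<Longrightarrow> a \<le> step k x a y"
  using W_step[of k x a y] strict_mono_less_eq[OF W_strict_mono[of k x], of a "step k x a y"] by simp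

lemma step_bounds:
  assumes "0 \<le> y"
  shows "\<alpha> * (step k x a y - a) \<le> y" "y \<le> \<beta> * (step k x a y - a)"
  using W_increment_lower[of a "step k x a y" k x] W_increment_upper[of a "step k x a y" k x]
  by (simp_all add: W_step step_ge assms)

text \<open>A higher level makes no point heavier, since \<open>h\<close> is antitone in the level, and a start further to
the right discards weight; in both cases the cell cannot end earlier.\<close>
lemma step_mono:
  assumes "x \<le> x'" "a \<le> a'" "0 \<le> y"
  shows "step k x a y \<le> step k x' a' y"
proof -
  let ?b' = "step k x' a' y"
  have "y = W k x' ?b' - W k x' a'" using W_step by simp
  also have "\<dots> \<le> W k x ?b' - W k x a'"
    by (rule W_increment_anti[OF step_ge[OF assms(3)] assms(1)])
  also have "\<dots> \<le> W k x ?b' - W k x a"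
    using strict_mono_less_eq[OF W_strict_mono[of k x], of a a'] assms(2) by simp
  finally have "W k x (step k x a y) \<le> W k x ?b'" using W_step by simp
  then show ?thesis by (simp add: strict_mono_less_eq[OF W_strict_mono])
qed

lemma continuous_on_step [continuous_intros]:
  assumes "continuous_on S x" "continuous_on S a" "continuous_on S y"
  shows "continuous_on S (\<lambda>t. step k (x t) (a t) (y t))"
proof (rule continuous_on_implicit_zero)
  show "continuous_on S (\<lambda>t. W k (x t) b - (W k (x t) (a t) + y t))" for b
    by (intro continuous_intros assms)
  show "strict_mono (\<lambda>b. W k (x t) b - (W k (x t) (a t) + y t))" for t
    using strict_monoD[OF W_strict_mono] by (auto intro: strict_monoI)
qed (simp add: W_step)

text \<open>\<open>shoot x \<nu> k\<close> is the level of the \<open>k\<close>-th cell paired with its left end point, when the first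
level is \<open>x\<close> and cell \<open>j\<close> receives weight \<open>\<nu> * c j\<close>.\<close>
primrec shoot :: "real \<Rightarrow> real \<Rightarrow> nat \<Rightarrow> real \<times> real" where
  "shoot x \<nu> 0 = (x, 0)"
| "shoot x \<nu> (Suc k) =
     (let (\<psi>, a) = shoot x \<nu> k; b = step k \<psi> a (\<nu> * c k) in (\<psi> + \<delta> * b, b))"

definition level :: "real \<Rightarrow> real \<Rightarrow> nat \<Rightarrow> real" where
  "level x \<nu> k = fst (shoot x \<nu> k)"

definition knot :: "real \<Rightarrow> real \<Rightarrow> nat \<Rightarrow> real" where
  "knot x \<nu> k = snd (shoot x \<nu> k)"

lemma level_0: "level x \<nu> 0 = x" and knot_0: "knot x \<nu> 0 = 0"
  by (auto simp: level_def knot_def)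

lemma knot_Suc: "knot x \<nu> (Suc k) = step k (level x \<nu> k) (knot x \<nu> k) (\<nu> * c k)"
  by (simp add: level_def knot_def Let_def split: prod.splits)

lemma level_Suc: "level x \<nu> (Suc k) = level x \<nu> k + \<delta> * knot x \<nu> (Suc k)"
  by (simp add: level_def knot_def Let_def split: prod.splits)

lemma continuous_on_level_knot:
  assumes "continuous_on S x" "continuous_on S \<nu>"
  shows "continuous_on S (\<lambda>t. level (x t) (\<nu> t) k) \<and> continuous_on S (\<lambda>t. knot (x t) (\<nu> t) k)"
proof (induction k)
  case 0
  then show ?case by (simp add: level_0 knot_0 assms)
next
  case (Suc k)
  then show ?case unfolding level_Suc knot_Suc by (auto intro!: continuous_intros assms)
qed

lemma level_knot_mono:
  assumes "x \<le> x'" "0 \<le> \<nu>"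
  shows "level x \<nu> k \<le> level x' \<nu> k \<and> knot x \<nu> k \<le> knot x' \<nu> k"
proof (induction k)
  case 0
  then show ?case by (simp add: level_0 knot_0 assms)
next
  case (Suc k)
  have "knot x \<nu> (Suc k) \<le> knot x' \<nu> (Suc k)"
    unfolding knot_Suc using Suc assms c_nonneg by (intro step_mono) auto
  then show ?case using Suc \<delta>_nonneg by (auto simp: level_Suc intro!: add_mono mult_left_mono)
qed

lemma knot_increasing: "0 \<le> \<nu> \<Longrightarrow> knot x \<nu> k \<le> knot x \<nu> (Suc k)"
  by (simp add: knot_Suc step_ge c_nonneg)

lemma knot_nonneg: "0 \<le> \<nu> \<Longrightarrow> 0 \<le> knot x \<nu> k"
  by (induction k) (auto simp: knot_0 intro: order_trans[OF _ knot_increasing])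

text \<open>Adding up the cells: the total weight to the left of a knot is comparable with the position of the knot.
This pins down the last knot at \<open>\<nu> = 0\<close> and takes it beyond 1 for large \<open>\<nu>\<close>.\<close>
lemma knot_bounds:
  assumes "0 \<le> \<nu>"
  shows "\<alpha> * knot x \<nu> k \<le> \<nu> * sum c {..<k} \<and> \<nu> * sum c {..<k} \<le> \<beta> * knot x \<nu> k"
proof (induction k)
  case 0
  then show ?case by (simp add: knot_0)
next
  case (Suc k)
  show ?case
    using Suc step_bounds[of "\<nu> * c k" k "level x \<nu> k" "knot x \<nu> k"] c_nonneg assms
    by (simp add: knot_Suc algebra_simps)
qed

lemma level_bounds:
  assumes "0 \<le> \<nu>" "k \<le> n" "\<And>j. j \<le> n \<Longrightarrow> knot x \<nu> j \<le> A"
  shows "x \<le> level x \<nu> k \<and> level x \<nu> k \<le> x + real k * (\<delta> * A)"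
  using assms(2)
proof (induction k)
  case 0
  then show ?case by (simp add: level_0)
next
  case (Suc k)
  have "\<delta> * knot x \<nu> (Suc k) \<le> \<delta> * A"
    using Suc.prems assms(3) by (intro mult_left_mono[OF _ \<delta>_nonneg]) auto
  moreover have "0 \<le> \<delta> * knot x \<nu> (Suc k)" using knot_nonneg[OF assms(1)] \<delta>_nonneg by simp
  ultimately show ?case using Suc by (auto simp: level_Suc algebra_simps)
qed

text \<open>The shooting argument. For fixed \<open>\<nu>\<close> the balance \<open>M \<nu>\<close> is strictly increasing in the first
level \<open>x\<close> and changes sign, which defines the curve \<open>x \<nu>\<close>; along this curve the last knot is a
continuous function of the single parameter \<open>\<nu>\<close>.\<close>
lemma exists_balanced_cells:
  assumes c_total: "0 < sum c {..n}"
  obtains \<psi> a \<nu> where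
    "a 0 = 0" "a (Suc n) = 1" "\<And>k. a k \<le> a (Suc k)"
    "\<And>k. \<psi> (Suc k) = \<psi> k + \<delta> * a (Suc k)"
    "\<And>k. W k (\<psi> k) (a (Suc k)) - W k (\<psi> k) (a k) = \<nu> * c k"
    "(\<Sum>k\<le>n. c k * \<psi> k) = 0"
proof -
  define M where "M \<nu> x = (\<Sum>k\<le>n. c k * level x \<nu> k)" for \<nu> x
  have M_cont: "continuous_on S (\<lambda>t. M (\<nu> t) (x t))"
    if "continuous_on S x" "continuous_on S \<nu>" for S :: "real set" and x \<nu>
    unfolding M_def using continuous_on_level_knot[OF that] by (intro continuous_intros) auto
  have M_mono: "strict_mono (M \<nu>)" if "0 \<le> \<nu>" for \<nu>
  proof (rule strict_monoI)
    fix x x' :: real assume lt: "x < x'"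
    \<comment> \<open>Knots are monotone, so levels spread at least as much as the first levels do.\<close>
    have diff: "level x \<nu> k + (x' - x) \<le> level x' \<nu> k" for k
    proof (induction k)
      case (Suc k)
      have "\<delta> * knot x \<nu> (Suc k) \<le> \<delta> * knot x' \<nu> (Suc k)"
        using level_knot_mono[of x x' \<nu>] lt that \<delta>_nonneg by (auto intro!: mult_left_mono)
      then show ?case using Suc by (simp add: level_Suc)
    qed (simp add: level_0)
    have "M \<nu> x < M \<nu> x + sum c {..n} * (x' - x)" using c_total lt by simp
    also have "\<dots> = (\<Sum>k\<le>n. c k * (level x \<nu> k + (x' - x)))"
      by (simp add: M_def sum_distrib_right distrib_left sum.distrib)
    also have "\<dots> \<le> M \<nu> x'"
      unfolding M_def using diff c_nonneg by (intro sum_mono mult_left_mono) auto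
    finally show "M \<nu> x < M \<nu> x'" .
  qed
  have "\<exists>x. M \<nu> x = 0" if "0 \<le> \<nu>" for \<nu>
  proof -
    define A where "A = \<nu> * sum c {..n} / \<alpha>"
    define r where "r = real n * (\<delta> * A)"
    have A: "0 \<le> \<delta> * A"
      using that \<delta>_nonneg \<alpha>_pos c_total by (simp add: A_def)
    have knot_le: "knot x \<nu> j \<le> A" if "j \<le> n" for x j
    proof -
      have "\<alpha> * knot x \<nu> j \<le> \<nu> * sum c {..<j}" using knot_bounds \<open>0 \<le> \<nu>\<close> by blast
      also have "\<dots> \<le> \<nu> * sum c {..n}"
        using that \<open>0 \<le> \<nu>\<close> c_nonneg by (intro mult_left_mono sum_mono2) auto
      finally show ?thesis using \<alpha>_pos by (simp add: A_def field_simps)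
    qed
    have "level (- r) \<nu> k \<le> 0" if "k \<le> n" for k
    proof -
      have "real k * (\<delta> * A) \<le> r"
        unfolding r_def using that by (intro mult_right_mono A) auto
      then show ?thesis
        using level_bounds[OF \<open>0 \<le> \<nu>\<close> that knot_le, of "- r"] by auto
    qed
    then have "M \<nu> (- r) \<le> 0"
      unfolding M_def using c_nonneg by (auto intro!: sum_nonpos simp: mult_nonneg_nonpos)
    moreover have "0 \<le> M \<nu> 0"
      unfolding M_def using c_nonneg level_bounds[OF \<open>0 \<le> \<nu>\<close> _ knot_le]
      by (auto intro!: sum_nonneg)
    moreover have "- r \<le> 0" unfolding r_def using A
      by (metis mult_nonneg_nonneg neg_le_0_iff_le of_nat_0_le_iff)
    ultimately show ?thesis
      using IVT'[of "M \<nu>" "- r" 0 0] M_cont[of _ "\<lambda>x. x" "\<lambda>_. \<nu>"] by auto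
  qed
  then obtain x where x: "\<And>\<nu>. 0 \<le> \<nu> \<Longrightarrow> M \<nu> (x \<nu>) = 0" by metis
  have x_cont: "continuous_on {0..} x"
    by (rule continuous_on_implicit_zero[where G = M])
       (auto intro: M_cont M_mono x continuous_on_id continuous_on_const)
  have knot_cont: "continuous_on {0..} (\<lambda>\<nu>. knot (x \<nu>) \<nu> (Suc n))"
    using continuous_on_level_knot[OF x_cont continuous_on_id] by auto
  \<comment> \<open>The unit interval weighs at most \<open>\<beta>\<close>, so a total weight of \<open>\<beta>\<close> takes the
      last knot to at least 1.\<close>
  define \<Lambda> where "\<Lambda> = \<beta> / sum c {..n}"
  have \<beta>_pos: "0 < \<beta>" using h_lower[of 0 0 0] h_upper[of 0 0 0] \<alpha>_pos by linarith
  then have \<Lambda>: "0 \<le> \<Lambda>" "\<Lambda> * sum c {..n} = \<beta>" using c_total by (auto simp: \<Lambda>_def)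
  have "knot (x 0) 0 (Suc n) \<le> 0"
    using knot_bounds[of 0 "x 0" "Suc n"] \<alpha>_pos by (simp add: mult_le_0_iff)
  moreover have "1 \<le> knot (x \<Lambda>) \<Lambda> (Suc n)"
    using knot_bounds[of \<Lambda> "x \<Lambda>" "Suc n"] \<beta>_pos \<Lambda> by (simp add: lessThan_Suc_atMost)
  moreover have "continuous_on {0..\<Lambda>} (\<lambda>\<nu>. knot (x \<nu>) \<nu> (Suc n))"
    by (rule continuous_on_subset[OF knot_cont]) auto
  ultimately have "\<exists>\<nu>\<ge>0. \<nu> \<le> \<Lambda> \<and> knot (x \<nu>) \<nu> (Suc n) = 1"
    using \<Lambda>(1) by (intro IVT') auto
  then obtain \<nu> where \<nu>: "0 \<le> \<nu>" "knot (x \<nu>) \<nu> (Suc n) = 1" by blast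
  show thesis
  proof (rule that)
    show "knot (x \<nu>) \<nu> 0 = 0" "knot (x \<nu>) \<nu> (Suc n) = 1" by (simp_all add: knot_0 \<nu>)
    show "knot (x \<nu>) \<nu> k \<le> knot (x \<nu>) \<nu> (Suc k)" for k by (rule knot_increasing[OF \<nu>(1)])
    show "level (x \<nu>) \<nu> (Suc k) = level (x \<nu>) \<nu> k + \<delta> * knot (x \<nu>) \<nu> (Suc k)" for k
      by (rule level_Suc)
    show "W k (level (x \<nu>) \<nu> k) (knot (x \<nu>) \<nu> (Suc k))
        - W k (level (x \<nu>) \<nu> k) (knot (x \<nu>) \<nu> k) = \<nu> * c k" for k
      by (simp add: knot_Suc W_step)
    show "(\<Sum>k\<le>n. c k * level (x \<nu>) \<nu> k) = 0" using x[OF \<nu>(1)] by (simp add: M_def)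
  qed
qed

end

section \<open>Strategies of player 2 as mean-zero functions\<close>

lemma finite_Omega: "finite (Omega n)"
  by (simp add: Omega_def finite_PiE)

definition heads :: "nat \<Rightarrow> (nat \<Rightarrow> real) \<Rightarrow> nat" where
  "heads n \<omega> = card {q \<in> {1..n}. \<omega> q = 1}"

lemma heads_le: "heads n \<omega> \<le> n"
proof -
  have "card {q \<in> {1..n}. \<omega> q = 1} \<le> card {1..n}" by (rule card_mono) auto
  then show ?thesis by (simp add: heads_def)
qed

lemma exists_heads:
  assumes "k \<le> n"
  shows "\<exists>\<omega>\<in>Omega n. heads n \<omega> = k"
proof (rule bexI)
  let ?\<omega> = "\<lambda>q\<in>{1..n}. if q \<le> k then 1 else (-1::real)"
  have "{q \<in> {1..n}. ?\<omega> q = 1} = {1..k}" using assms by auto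
  then show "heads n ?\<omega> = k" by (simp add: heads_def)
  show "?\<omega> \<in> Omega n" by (auto simp: Omega_def)
qed

lemma Sn_eq_heads:
  assumes "\<omega> \<in> Omega n"
  shows "Sn n \<omega> = (2 * real (heads n \<omega>) - real n) / sqrt (real n)"
proof -
  have "\<omega> q = 2 * of_bool (\<omega> q = 1) - 1" if "q \<in> {1..n}" for q
    using assms that by (fastforce simp: Omega_def)
  then have "(\<Sum>q=1..n. \<omega> q) = (\<Sum>q=1..n. 2 * of_bool (\<omega> q = 1) - 1)"
    by (rule sum.cong[OF refl])
  also have "\<dots> = 2 * (\<Sum>q=1..n. of_bool (\<omega> q = 1)) - real n"
    by (simp only: sum_subtractf sum_distrib_left[symmetric]) simp
  also have "(\<Sum>q=1..n. of_bool (\<omega> q = 1)) = real (heads n \<omega>)"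
    by (simp add: of_bool_def sum.If_cases heads_def Int_def)
  finally show ?thesis by (simp add: Sn_def)
qed

lemma sum_by_heads:
  fixes g :: "nat \<Rightarrow> real"
  shows "(\<Sum>\<omega>\<in>Omega n. g (heads n \<omega>)) = (\<Sum>k\<le>n. real (card {\<omega> \<in> Omega n. heads n \<omega> = k}) * g k)"
proof -
  have "(\<Sum>\<omega>\<in>Omega n. g (heads n \<omega>)) = (\<Sum>k\<le>n. \<Sum>\<omega>\<in>{\<omega> \<in> Omega n. heads n \<omega> = k}. g (heads n \<omega>))"
    by (rule sum.group[symmetric]) (auto simp: finite_Omega heads_le)
  also have "\<dots> = (\<Sum>k\<le>n. real (card {\<omega> \<in> Omega n. heads n \<omega> = k}) * g k)"
    by (intro sum.cong refl) simp
  finally show ?thesis .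
qed

text \<open>The price at stage \<open>q\<close> does not depend on the move at stage \<open>q\<close>, so reversing that move changes
the sign of the stage payoff and the sum over all histories cancels in pairs.\<close>
lemma sum_price_fun: "(\<Sum>\<omega>\<in>Omega n. price_fun n p \<omega>) = 0"
proof -
  let ?X = "\<lambda>q \<omega>. \<omega> q * p q (restrict \<omega> {1..<q})"
  have "(\<Sum>\<omega>\<in>Omega n. ?X q \<omega>) = 0" if q: "q \<in> {1..n}" for q
  proof -
    define flip where "flip \<omega> = \<omega> (q := - \<omega> q)" for \<omega> :: "nat \<Rightarrow> real"
    have "flip \<omega> \<in> Omega n" if "\<omega> \<in> Omega n" for \<omega>
      using that q by (auto simp: Omega_def flip_def PiE_def Pi_def extensional_def)
    then have bij: "bij_betw flip (Omega n) (Omega n)"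
      by (intro bij_betwI[where g = flip]) (auto simp: flip_def)
    have "(\<Sum>\<omega>\<in>Omega n. ?X q \<omega>) = (\<Sum>\<omega>\<in>Omega n. ?X q (flip \<omega>))"
      by (rule sum.reindex_bij_betw[OF bij, symmetric])
    also have "\<dots> = (\<Sum>\<omega>\<in>Omega n. - ?X q \<omega>)"
      by (intro sum.cong refl) (auto simp: flip_def restrict_def intro!: arg_cong[where f = "p q"])
    also have "\<dots> = - (\<Sum>\<omega>\<in>Omega n. ?X q \<omega>)" by (rule sum_negf)
    finally show ?thesis by simp
  qed
  then have "(\<Sum>q=1..n. \<Sum>\<omega>\<in>Omega n. ?X q \<omega>) = 0" by (intro sum.neutral) auto
  then have "(\<Sum>\<omega>\<in>Omega n. \<Sum>q=1..n. ?X q \<omega>) = 0" by (subst sum.swap) 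
  then show ?thesis by (simp add: price_fun_def sum_divide_distrib[symmetric])
qed

lemma sum_Omega_Suc:
  fixes f :: "(nat \<Rightarrow> real) \<Rightarrow> real"
  shows "(\<Sum>\<omega>\<in>Omega (Suc n). f \<omega>) = (\<Sum>\<omega>\<in>Omega n. f (\<omega> (Suc n := 1)) + f (\<omega> (Suc n := -1)))"
proof -
  have Omega: "Omega (Suc n) = (\<lambda>(y, \<omega>). \<omega> (Suc n := y)) ` ({-1, 1} \<times> Omega n)"
    using PiE_insert_eq[of "Suc n" "{1..n}" "\<lambda>_. {-1, 1::real}"]
    by (simp add: Omega_def atLeastAtMostSuc_conv)
  have inj: "inj_on (\<lambda>(y, \<omega>). \<omega> (Suc n := y)) ({-1, 1::real} \<times> Omega n)"
    using inj_combinator[of "Suc n" "{1..n}" "\<lambda>_. {-1, 1::real}"] by (simp add: Omega_def)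
  have "(\<Sum>\<omega>\<in>Omega (Suc n). f \<omega>) = (\<Sum>(y, \<omega>)\<in>{-1, 1} \<times> Omega n. f (\<omega> (Suc n := y)))"
    unfolding Omega by (subst sum.reindex[OF inj]) (simp add: comp_def case_prod_unfold)
  also have "\<dots> = (\<Sum>y\<in>{-1, 1::real}. \<Sum>\<omega>\<in>Omega n. f (\<omega> (Suc n := y)))"
    by (rule sum.cartesian_product[symmetric])
  finally show ?thesis by (simp add: sum.distrib)
qed

text \<open>The binary tree is a complete market: every function of the history is its mean plus a sum of stage
gains. Averaging over the last move yields a function of the earlier moves, and the last price is half
the difference between the two possible outcomes.\<close>
lemma predictable_representation:
  fixes f :: "(nat \<Rightarrow> real) \<Rightarrow> real"
  shows "\<exists>p. \<forall>\<omega>\<in>Omega n. f \<omega> = (\<Sum>\<omega>'\<in>Omega n. f \<omega>') / 2 ^ n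
    + (\<Sum>q=1..n. \<omega> q * p q (restrict \<omega> {1..<q}))"
proof (induction n arbitrary: f)
  case 0
  then show ?case by (simp add: Omega_def)
next
  case (Suc n)
  define g where "g \<omega> = (f (\<omega> (Suc n := 1)) + f (\<omega> (Suc n := -1))) / 2" for \<omega>
  define d where "d \<omega> = (f (\<omega> (Suc n := 1)) - f (\<omega> (Suc n := -1))) / 2" for \<omega>
  from Suc obtain p where p: "\<And>\<omega>. \<omega> \<in> Omega n \<Longrightarrow> g \<omega> = (\<Sum>\<omega>'\<in>Omega n. g \<omega>') / 2 ^ n
    + (\<Sum>q=1..n. \<omega> q * p q (restrict \<omega> {1..<q}))" by metis
  have mean: "(\<Sum>\<omega>'\<in>Omega n. g \<omega>') / 2 ^ n = (\<Sum>\<omega>'\<in>Omega (Suc n). f \<omega>') / 2 ^ Suc n"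
    by (simp add: sum_Omega_Suc g_def sum_divide_distrib[symmetric])
  show ?case
  proof (intro exI[of _ "p(Suc n := d)"] ballI)
    fix \<omega> assume \<omega>: "\<omega> \<in> Omega (Suc n)"
    define \<eta> where "\<eta> = restrict \<omega> {1..n}"
    have \<eta>: "\<eta> \<in> Omega n" using \<omega> by (auto simp: \<eta>_def Omega_def)
    have ext: "\<eta>(Suc n := \<omega> (Suc n)) = \<omega>"
      using \<omega> by (auto simp: \<eta>_def Omega_def fun_eq_iff PiE_def extensional_def restrict_def)
    have "\<omega> (Suc n) = 1 \<or> \<omega> (Suc n) = -1" using \<omega> by (auto simp: Omega_def)
    then have split: "f \<omega> = g \<eta> + \<omega> (Suc n) * d \<eta>"
      using ext by (auto simp: g_def d_def field_simps)
    have past: "(\<Sum>q=1..n. \<eta> q * p q (restrict \<eta> {1..<q}))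
        = (\<Sum>q=1..n. \<omega> q * (p(Suc n := d)) q (restrict \<omega> {1..<q}))"
    proof (intro sum.cong refl)
      fix q assume q: "q \<in> {1..n}"
      then have "restrict \<eta> {1..<q} = restrict \<omega> {1..<q}"
        by (auto simp: \<eta>_def restrict_def fun_eq_iff)
      then show "\<eta> q * p q (restrict \<eta> {1..<q}) = \<omega> q * (p(Suc n := d)) q (restrict \<omega> {1..<q})"
        using q by (simp add: \<eta>_def)
    qed
    have last: "d \<eta> = (p(Suc n := d)) (Suc n) (restrict \<omega> {1..<Suc n})"
      by (simp add: \<eta>_def atLeastLessThanSuc_atLeastAtMost)
    show "f \<omega> = (\<Sum>\<omega>'\<in>Omega (Suc n). f \<omega>') / 2 ^ Suc n
        + (\<Sum>q=1..Suc n. \<omega> q * (p(Suc n := d)) q (restrict \<omega> {1..<q}))"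
      unfolding split p[OF \<eta>] mean past last sum.cl_ivl_Suc by (simp del: fun_upd_apply)
  qed
qed

lemma mean_zero_in_strategies2:
  assumes "n \<ge> 1" "(\<Sum>\<omega>\<in>Omega n. f \<omega>) = 0"
  shows "restrict f (Omega n) \<in> strategies2 n"
proof -
  obtain p where p: "\<forall>\<omega>\<in>Omega n. f \<omega> = (\<Sum>\<omega>'\<in>Omega n. f \<omega>') / 2 ^ n
    + (\<Sum>q=1..n. \<omega> q * p q (restrict \<omega> {1..<q}))"
    using predictable_representation by blast
  have "restrict f (Omega n) = price_fun n (\<lambda>q \<eta>. sqrt (real n) * p q \<eta>)"
    unfolding price_fun_def
  proof (rule restrict_ext)
    fix \<omega> assume \<omega>: "\<omega> \<in> Omega n"
    have "(\<Sum>q=1..n. \<omega> q * (sqrt (real n) * p q (restrict \<omega> {1..<q})))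
      = sqrt (real n) * (\<Sum>q=1..n. \<omega> q * p q (restrict \<omega> {1..<q}))"
      by (simp add: sum_distrib_left mult_ac)
    then show "f \<omega> = 1 / sqrt (real n) * (\<Sum>q=1..n. \<omega> q * (sqrt (real n) * p q (restrict \<omega> {1..<q})))"
      using p \<omega> assms by simp
  qed
  then show ?thesis by (simp add: strategies2_def)
qed

section \<open>The risk function and the prior\<close>

lemma strictly_convex_imp_convex:
  assumes "strictly_convex H"
  shows "convex_on UNIV H"
proof (rule convex_onI)
  fix t x y :: real
  assume t: "0 < t" "t < 1"
  show "H ((1 - t) *\<^sub>R x + t *\<^sub>R y) \<le> (1 - t) * H x + t * H y"
  proof (cases "x = y")
    case True
    then show ?thesis by (simp add: algebra_simps)
  next
    case False
    then have "H ((1 - t) * x + t * y) < (1 - t) * H x + t * H y"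
      using assms t unfolding strictly_convex_def by blast
    then show ?thesis by simp
  qed
qed simp

lemma admissible_riskE:
  assumes "admissible_risk H"
  obtains H' C \<epsilon> K where
    "\<And>x. (H has_real_derivative H' x) (at x)"
    "continuous_on UNIV H'" "\<And>x y. x \<le> y \<Longrightarrow> H' x \<le> H' y"
    "\<And>x y. H x + H' x * (y - x) \<le> H y"
    "\<And>x y. \<bar>H' x - H' y\<bar> \<le> C * \<bar>x - y\<bar>" "0 < \<epsilon>" "\<And>x. \<epsilon> \<le> H' x" "\<And>x. H' x \<le> K"
proof -
  obtain H' H'' C \<epsilon> K where H': "\<And>x. (H has_real_derivative H' x) (at x)"
    and H'': "\<And>x. (H' has_real_derivative H'' x) (at x)"
    and C: "C-lipschitz_on UNIV H'" and bounds: "0 < \<epsilon>" "\<And>x. \<epsilon> < H' x" "\<And>x. H' x < K"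
    and conv: "convex_on UNIV H"
    using assms strictly_convex_imp_convex unfolding admissible_risk_def by blast
  have tangent: "H x + H' x * (y - x) \<le> H y" for x y
    using convex_on_imp_above_tangent[OF conv, of x y "H' x"] H' by auto
  have "H' x \<le> H' y" if "x \<le> y" for x y
  proof (cases "x = y")
    case False
    have "0 \<le> (H' y - H' x) * (y - x)"
      using tangent[of x y] tangent[of y x] by (simp add: algebra_simps)
    then show ?thesis using that False by (simp add: zero_le_mult_iff)
  qed simp
  moreover have "continuous_on UNIV H'"
    by (intro continuous_at_imp_continuous_on ballI DERIV_isCont[OF H''])
  moreover have "\<bar>H' x - H' y\<bar> \<le> C * \<bar>x - y\<bar>" for x y
    using lipschitz_onD[OF C, of x y] by (simp add: dist_real_def)
  ultimately show thesis
    by (intro that[of H' C \<epsilon> K] H' tangent less_imp_le[OF bounds(2)] less_imp_le[OF bounds(3)] bounds(1))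
qed

text \<open>The density is prolonged by its end point values to a continuous function on the line. This leaves the
prior unchanged and keeps the density bounded away from zero, as shooting beyond \<open>[0,1]\<close> requires.\<close>
lemma admissible_priorE:
  assumes "admissible_prior \<mu>"
  obtains F m B where
    "prob_space \<mu>" "\<mu> = density lborel (\<lambda>l. ennreal (F l * indicator {0..1} l))"
    "continuous_on UNIV F" "0 < m" "\<And>l. m \<le> F l" "\<And>l. F l \<le> B"
proof -
  obtain f f' where f: "prob_space \<mu>" "\<mu> = density lborel (\<lambda>x. ennreal (f x * indicator {0..1} x))"
    "\<And>x. x \<in> {0..1} \<Longrightarrow> 0 < f x"
    "\<And>x. x \<in> {0..1} \<Longrightarrow> (f has_real_derivative f' x) (at x within {0..1})"
    using assms unfolding admissible_prior_def by blast
  have cont: "continuous_on {0..1} f" using f(4) by (rule DERIV_continuous_on)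
  obtain u where u: "u \<in> {0..1}" "\<And>x. x \<in> {0..1} \<Longrightarrow> f u \<le> f x"
    using continuous_attains_inf[OF _ _ cont] by auto
  obtain v where v: "\<And>x. x \<in> {0..1} \<Longrightarrow> f x \<le> f v"
    using continuous_attains_sup[OF _ _ cont] by (metis atLeastAtMost_iff compact_Icc empty_iff order_refl zero_le_one)
  define clamp where "clamp l = max 0 (min 1 l)" for l :: real
  have clamp: "clamp l \<in> {0..1}" "l \<in> {0..1} \<Longrightarrow> clamp l = l" for l by (auto simp: clamp_def)
  show thesis
  proof (rule that[of "\<lambda>l. f (clamp l)" "f u" "f v"])
    show "\<mu> = density lborel (\<lambda>l. ennreal (f (clamp l) * indicator {0..1} l))"
      unfolding f(2) by (intro arg_cong[where f = "density lborel"] ext) (simp add: clamp indicator_def)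
    have "continuous_on UNIV clamp" unfolding clamp_def by (intro continuous_intros)
    then show "continuous_on UNIV (\<lambda>l. f (clamp l))"
      by (rule continuous_on_compose2[OF cont]) (use clamp in auto)
  qed (use f(1,3) u v clamp in auto)
qed

section \<open>Strategies of player 1 and optimality criteria\<close>

lemma strategies1D:
  assumes "P \<in> strategies1 n \<mu>"
  shows "prob_space P" "sets P = sets (count_space (Omega n) \<Otimes>\<^sub>M borel)"
    "space P = Omega n \<times> UNIV" "snd \<in> measurable P borel" "distr P borel snd = \<mu>"
proof -
  show P: "prob_space P" "sets P = sets (count_space (Omega n) \<Otimes>\<^sub>M borel)" "distr P borel snd = \<mu>"
    using assms by (auto simp: strategies1_def)
  show "space P = Omega n \<times> UNIV"
    using sets_eq_imp_space_eq[OF P(2)] by (simp add: space_pair_measure)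
  show "snd \<in> measurable P borel"
    using measurable_snd[of "count_space (Omega n)" borel] measurable_cong_sets[OF P(2) refl] by blast
qed

lemma integrable_strategies1:
  assumes P: "P \<in> strategies1 n \<mu>" and \<mu>: "AE l in \<mu>. l \<in> {0..1}"
    and G: "\<And>\<omega>. \<omega> \<in> Omega n \<Longrightarrow> continuous_on UNIV (\<lambda>l. G (\<omega>, l :: real) :: real)"
  shows "integrable P G"
proof -
  note D = strategies1D[OF P]
  interpret prob_space P by (rule D)
  have "\<exists>b. \<forall>l\<in>{0..1}. \<bar>G (\<omega>, l)\<bar> \<le> b" if "\<omega> \<in> Omega n" for \<omega>
  proof -
    have "compact ((\<lambda>l. G (\<omega>, l)) ` {0..1})"
      using continuous_on_subset[OF G[OF that]] by (intro compact_continuous_image) auto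
    then show ?thesis by (auto simp: bounded_iff dest!: compact_imp_bounded)
  qed
  then obtain b where b: "\<And>\<omega> l. \<omega> \<in> Omega n \<Longrightarrow> l \<in> {0..1} \<Longrightarrow> \<bar>G (\<omega>, l)\<bar> \<le> b \<omega>" by metis
  have bound: "\<bar>G (\<omega>, l)\<bar> \<le> (\<Sum>\<omega>\<in>Omega n. \<bar>b \<omega>\<bar>)" if "\<omega> \<in> Omega n" "l \<in> {0..1}" for \<omega> l
  proof -
    have "\<bar>b \<omega>\<bar> \<le> (\<Sum>\<omega>\<in>Omega n. \<bar>b \<omega>\<bar>)"
      by (rule member_le_sum) (auto simp: finite_Omega that)
    then show ?thesis using b[OF that] by linarith
  qed
  have "AE x in P. snd x \<in> {0..1}"
    using AE_distrD[OF D(4), of "\<lambda>l. l \<in> {0..1}", unfolded D(5)] \<mu> by blast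
  then have "AE x in P. norm (G x) \<le> (\<Sum>\<omega>\<in>Omega n. \<bar>b \<omega>\<bar>)"
    using AE_space by eventually_elim (auto simp: D(3) bound)
  moreover have "G \<in> borel_measurable (count_space (Omega n) \<Otimes>\<^sub>M borel)"
    by (intro measurable_pair_measure_countable1 countable_finite finite_Omega
        borel_measurable_continuous_onI G)
  then have "G \<in> borel_measurable P" using measurable_cong_sets[OF D(2) refl] by blast
  ultimately show ?thesis by (intro integrable_const_bound)
qed

text \<open>Player 1 never gets more than the upper envelope \<open>\<phi>\<close> of the payoff lines, whose expectation depends
on the marginal law of \<open>L\<close> only; it suffices to attain \<open>\<phi>\<close> almost surely.\<close>
lemma g1_compare_envelope:
  assumes P: "P \<in> strategies1 n \<mu>" and \<mu>: "AE l in \<mu>. l \<in> {0..1}"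
    and \<phi>: "continuous_on UNIV \<phi>"
  shows "(\<And>\<omega> l. \<omega> \<in> Omega n \<Longrightarrow> l * Sn n \<omega> - X \<omega> \<le> \<phi> l) \<Longrightarrow> g1 n P X \<le> integral\<^sup>L \<mu> \<phi>"
    and "(AE (\<omega>, l) in P. l * Sn n \<omega> - X \<omega> = \<phi> l) \<Longrightarrow> g1 n P X = integral\<^sup>L \<mu> \<phi>"
proof -
  note D = strategies1D[OF P]
  have int: "integrable P (\<lambda>(\<omega>, l). l * Sn n \<omega> - X \<omega>)" "integrable P (\<lambda>x. \<phi> (snd x))"
    by (rule integrable_strategies1[OF P \<mu>]; auto intro!: continuous_intros \<phi>)+
  have \<phi>_eq: "integral\<^sup>L \<mu> \<phi> = (\<integral>x. \<phi> (snd x) \<partial>P)"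
    unfolding D(5)[symmetric]
    by (rule integral_distr[OF D(4)]) (simp add: borel_measurable_continuous_onI \<phi>)
  show "g1 n P X \<le> integral\<^sup>L \<mu> \<phi>" if "\<And>\<omega> l. \<omega> \<in> Omega n \<Longrightarrow> l * Sn n \<omega> - X \<omega> \<le> \<phi> l"
    unfolding g1_def \<phi>_eq by (rule integral_mono[OF int]) (auto simp: D(3) that)
  show "g1 n P X = integral\<^sup>L \<mu> \<phi>" if "AE (\<omega>, l) in P. l * Sn n \<omega> - X \<omega> = \<phi> l"
    unfolding g1_def \<phi>_eq using that int
    by (intro integral_cong_AE) (auto simp: case_prod_unfold)
qed

text \<open>The strategy under which \<open>\<rho> \<omega>\<close> is the density of \<open>L\<close> on the event that the moves are
\<open>\<omega>\<close>. With a density instead of conditional laws given \<open>L\<close>, integrals become finite sums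
of Lebesgue integrals.\<close>
definition joint_law :: "nat \<Rightarrow> ((nat \<Rightarrow> real) \<Rightarrow> real \<Rightarrow> real) \<Rightarrow> ((nat \<Rightarrow> real) \<times> real) measure" where
  "joint_law n \<rho> = density (count_space (Omega n) \<Otimes>\<^sub>M lborel) (\<lambda>x. ennreal (\<rho> (fst x) (snd x)))"

context
  fixes n :: nat and \<rho> :: "(nat \<Rightarrow> real) \<Rightarrow> real \<Rightarrow> real"
  assumes \<rho>_meas: "\<And>\<omega>. \<omega> \<in> Omega n \<Longrightarrow> \<rho> \<omega> \<in> borel_measurable borel"
    and \<rho>_nonneg: "\<And>\<omega> l. 0 \<le> \<rho> \<omega> l"
begin

lemma measurable_\<rho> [measurable]:
  "(\<lambda>x. \<rho> (fst x) (snd x)) \<in> borel_measurable (count_space (Omega n) \<Otimes>\<^sub>M lborel)"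
  by (intro measurable_pair_measure_countable1 countable_finite finite_Omega) (simp add: \<rho>_meas)

lemma joint_law_in_strategies1:
  assumes \<mu>: "\<mu> = density lborel (\<lambda>l. ennreal (r l))" "prob_space \<mu>"
    and r: "r \<in> borel_measurable borel"
    and marginal: "AE l in lborel. (\<Sum>\<omega>\<in>Omega n. \<rho> \<omega> l) = r l"
  shows "joint_law n \<rho> \<in> strategies1 n \<mu>"
proof -
  let ?M = "count_space (Omega n) \<Otimes>\<^sub>M lborel"
  have sets: "sets (joint_law n \<rho>) = sets (count_space (Omega n) \<Otimes>\<^sub>M borel)"
    unfolding joint_law_def sets_density by (intro sets_pair_measure_cong) auto
  then have snd: "snd \<in> measurable (joint_law n \<rho>) borel"
    using measurable_snd[of "count_space (Omega n)" borel] measurable_cong_sets[OF sets refl] by blast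
  have "distr (joint_law n \<rho>) borel snd = \<mu>"
  proof (rule measure_eqI)
    show "sets (distr (joint_law n \<rho>) borel snd) = sets \<mu>" by (simp add: \<mu>(1))
    fix A assume "A \<in> sets (distr (joint_law n \<rho>) borel snd)"
    then have A[measurable]: "A \<in> sets borel" by simp
    have V: "snd -` A \<inter> space ?M \<in> sets ?M" by measurable
    have "emeasure (distr (joint_law n \<rho>) borel snd) A
        = emeasure (joint_law n \<rho>) (snd -` A \<inter> space ?M)"
      unfolding emeasure_distr[OF snd A] by (simp add: joint_law_def)
    also have "\<dots> = (\<integral>\<^sup>+x. ennreal (\<rho> (fst x) (snd x)) * indicator (snd -` A \<inter> space ?M) x \<partial>?M)"
      unfolding joint_law_def by (rule emeasure_density[OF _ V]) measurable
    also have "\<dots> = (\<integral>\<^sup>+x. ennreal (\<rho> (fst x) (snd x)) * indicator A (snd x) \<partial>?M)"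
      by (intro nn_integral_cong) (auto simp: indicator_def)
    also have "\<dots> = (\<integral>\<^sup>+\<omega>. \<integral>\<^sup>+l. ennreal (\<rho> \<omega> l) * indicator A l \<partial>lborel \<partial>count_space (Omega n))"
      by (subst lborel.nn_integral_fst[symmetric]) auto
    also have "\<dots> = (\<Sum>\<omega>\<in>Omega n. \<integral>\<^sup>+l. ennreal (\<rho> \<omega> l) * indicator A l \<partial>lborel)"
      by (rule nn_integral_count_space_finite[OF finite_Omega])
    also have "\<dots> = (\<integral>\<^sup>+l. (\<Sum>\<omega>\<in>Omega n. ennreal (\<rho> \<omega> l) * indicator A l) \<partial>lborel)"
      using \<rho>_meas by (intro nn_integral_sum[symmetric]) auto
    also have "\<dots> = (\<integral>\<^sup>+l. ennreal (r l) * indicator A l \<partial>lborel)"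
    proof (intro nn_integral_cong_AE)
      show "AE l in lborel. (\<Sum>\<omega>\<in>Omega n. ennreal (\<rho> \<omega> l) * indicator A l) = ennreal (r l) * indicator A l"
        using marginal
        by eventually_elim (auto simp: sum_distrib_right[symmetric] \<rho>_nonneg sum_ennreal)
    qed
    also have "\<dots> = emeasure \<mu> A"
      unfolding \<mu>(1) using r by (intro emeasure_density[symmetric]) auto
    finally show "emeasure (distr (joint_law n \<rho>) borel snd) A = emeasure \<mu> A" .
  qed
  moreover have "prob_space (joint_law n \<rho>)"
    using prob_space_distrD[OF snd] calculation \<mu>(2) by simp
  ultimately show ?thesis using sets by (simp add: strategies1_def)
qed

lemma integral_joint_law:
  fixes G :: "(nat \<Rightarrow> real) \<times> real \<Rightarrow> real"
  assumes "integrable (joint_law n \<rho>) G"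
  shows "integral\<^sup>L (joint_law n \<rho>) G = (\<Sum>\<omega>\<in>Omega n. \<integral>l. \<rho> \<omega> l * G (\<omega>, l) \<partial>lborel)"
proof -
  interpret C: sigma_finite_measure "count_space (Omega n)"
    by (rule sigma_finite_measure_count_space_finite[OF finite_Omega])
  interpret pair_sigma_finite "count_space (Omega n)" lborel ..
  have G[measurable]: "G \<in> borel_measurable (count_space (Omega n) \<Otimes>\<^sub>M lborel)"
    using borel_measurable_integrable[OF assms] by (simp add: joint_law_def)
  have int: "integrable (count_space (Omega n) \<Otimes>\<^sub>M lborel) (\<lambda>x. \<rho> (fst x) (snd x) * G x)"
    using assms by (simp add: joint_law_def integrable_density \<rho>_nonneg)
  have fubini: "(\<integral>\<omega>. \<integral>l. \<rho> \<omega> l * G (\<omega>, l) \<partial>lborel \<partial>count_space (Omega n))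
      = (\<integral>x. \<rho> (fst x) (snd x) * G x \<partial>(count_space (Omega n) \<Otimes>\<^sub>M lborel))"
    using integral_fst'[OF int] by (simp only: fst_conv snd_conv)
  show ?thesis
    unfolding lebesgue_integral_count_space_finite[OF finite_Omega, symmetric] fubini joint_law_def
    by (subst integral_density) (auto simp: \<rho>_nonneg)
qed

end

text \<open>Sufficiency of the first order condition: by the tangent inequality, deviating from \<open>X\<close> to
\<open>X'\<close> changes the risk by at least the expectation of \<open>H'(L S - X) (X - X')\<close>. The hypothesis
\<open>equal\<close>, stated in weak form against test functions \<open>y\<close>, says that all marginal risks equal
\<open>\<nu>\<close>; hence this expectation is \<open>\<nu>\<close> times the sum of \<open>X - X'\<close>, which vanishes.\<close>
lemma g2_minimal_if_equalized:
  assumes H': "\<And>x. (H has_real_derivative H' x) (at x)" "continuous_on UNIV H'"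
    and tangent: "\<And>x y. H x + H' x * (y - x) \<le> H y"
    and P: "P \<in> strategies1 n \<mu>" and \<mu>: "AE l in \<mu>. l \<in> {0..1}"
    and X: "(\<Sum>\<omega>\<in>Omega n. X \<omega>) = 0" "(\<Sum>\<omega>\<in>Omega n. X' \<omega>) = 0"
    and equal: "\<And>y. (\<integral>x. H' (snd x * Sn n (fst x) - X (fst x)) * y (fst x) \<partial>P)
      = \<nu> * (\<Sum>\<omega>\<in>Omega n. y \<omega>)"
  shows "g2 n H P X \<le> g2 n H P X'"
proof -
  let ?z = "\<lambda>Y x. snd x * Sn n (fst x) - Y (fst x)"
  have H: "continuous_on UNIV H"
    by (intro continuous_at_imp_continuous_on ballI DERIV_isCont[OF H'(1)])
  have affine: "continuous_on UNIV (\<lambda>l. l * u - v)" for u v :: real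
    by (intro continuous_intros)
  have H_affine: "continuous_on UNIV (\<lambda>l. H (l * u - v))" "continuous_on UNIV (\<lambda>l. H' (l * u - v))" for u v
    by (rule continuous_on_compose2[OF H affine subset_UNIV]
        continuous_on_compose2[OF H'(2) affine subset_UNIV])+
  have int: "integrable P (\<lambda>x. H (?z Y x))"
    "integrable P (\<lambda>x. H' (?z X x) * (X (fst x) - X' (fst x)))" for Y
    by (rule integrable_strategies1[OF P \<mu>], simp only: fst_conv snd_conv,
        intro continuous_on_mult continuous_on_const H_affine)+
  have "g2 n H P X = (\<integral>x. H (?z X x) \<partial>P) + (\<integral>x. H' (?z X x) * (X (fst x) - X' (fst x)) \<partial>P)"
    using equal[of "\<lambda>\<omega>. X \<omega> - X' \<omega>"] by (simp add: g2_def case_prod_unfold sum_subtractf X)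
  also have "\<dots> = (\<integral>x. H (?z X x) + H' (?z X x) * (X (fst x) - X' (fst x)) \<partial>P)"
    by (rule Bochner_Integration.integral_add[OF int, symmetric])
  also have "\<dots> \<le> (\<integral>x. H (?z X' x) \<partial>P)"
  proof (rule integral_mono)
    show "integrable P (\<lambda>x. H (?z X x) + H' (?z X x) * (X (fst x) - X' (fst x)))"
      by (rule Bochner_Integration.integrable_add[OF int])
    show "integrable P (\<lambda>x. H (?z X' x))" by (rule int)
    have diff: "?z X' x - ?z X x = X (fst x) - X' (fst x)" for x by simp
    show "H (?z X x) + H' (?z X x) * (X (fst x) - X' (fst x)) \<le> H (?z X' x)" for x
      using tangent[of "?z X x" "?z X' x"] unfolding diff .
  qed
  finally show ?thesis by (simp add: g2_def case_prod_unfold)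
qed

section \<open>The upper envelope of the payoff lines\<close>

lemma sum_indicator_cells:
  fixes a :: "nat \<Rightarrow> real"
  assumes mono: "\<And>k. a k \<le> a (Suc k)" and l: "l \<notin> range a"
  shows "(\<Sum>k<N. indicator {a k..a (Suc k)} l :: real) = indicator {a 0..a N} l"
proof (induction N)
  case 0
  then show ?case using l by (auto simp: indicator_def)
next
  case (Suc N)
  have "a 0 \<le> a N" by (rule lift_Suc_mono_le[of a, OF mono]) simp
  moreover have "l \<noteq> a N" using l by auto
  ultimately show ?case using Suc mono[of N] by (auto simp: indicator_def)
qed

text \<open>Passing from line \<open>j\<close> to line \<open>Suc j\<close> gains \<open>\<delta> * (l - a (Suc j))\<close>. Keeping exactly the
positive gains gives the envelope \<open>\<phi>\<close>, and because the crossing points increase, the gains are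
nonnegative up to the cell of \<open>l\<close> and nonpositive from there on. This form makes continuity of
\<open>\<phi>\<close> evident.\<close>
context
  fixes a s \<psi> :: "nat \<Rightarrow> real" and \<delta> :: real and n :: nat and \<phi> :: "real \<Rightarrow> real"
  assumes a_mono: "\<And>k. a k \<le> a (Suc k)" and \<delta>: "0 \<le> \<delta>"
    and \<psi>_Suc: "\<And>k. \<psi> (Suc k) = \<psi> k + \<delta> * a (Suc k)"
    and s_Suc: "\<And>k. s (Suc k) = s k + \<delta>"
  defines "\<phi> \<equiv> \<lambda>l. l * s 0 - \<psi> 0 + (\<Sum>j<n. max 0 (\<delta> * (l - a (Suc j))))"
begin

lemma line_as_truncated_envelope:
  assumes "k \<le> n"
  shows "l * s k - \<psi> k = l * s 0 - \<psi> 0 + (\<Sum>j<n. if j < k then \<delta> * (l - a (Suc j)) else 0)"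
proof -
  have "l * s k - \<psi> k = l * s 0 - \<psi> 0 + (\<Sum>j<k. \<delta> * (l - a (Suc j)))"
    by (induction k) (simp_all add: s_Suc \<psi>_Suc algebra_simps)
  also have "(\<Sum>j<k. \<delta> * (l - a (Suc j))) = (\<Sum>j<n. if j < k then \<delta> * (l - a (Suc j)) else 0)"
    using assms by (intro sum.mono_neutral_cong_left) auto
  finally show ?thesis .
qed

lemma line_le_envelope:
  assumes "k \<le> n"
  shows "l * s k - \<psi> k \<le> \<phi> l"
  unfolding line_as_truncated_envelope[OF assms] \<phi>_def by (intro add_left_mono sum_mono) auto

lemma line_eq_envelope:
  assumes "k \<le> n" "l \<in> {a k..a (Suc k)}"
  shows "l * s k - \<psi> k = \<phi> l"
proof -
  have "a (Suc j) \<le> l" if "j < k" for j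
    using lift_Suc_mono_le[of a "Suc j" k, OF a_mono] that assms(2) by auto
  moreover have "l \<le> a (Suc j)" if "k \<le> j" for j
    using lift_Suc_mono_le[of a "Suc k" "Suc j", OF a_mono] that assms(2) by auto
  ultimately show ?thesis
    unfolding line_as_truncated_envelope[OF assms(1)] \<phi>_def
    using \<delta> by (intro arg_cong2[where f = "(+)"] refl sum.cong)
      (auto simp: max_def mult_le_0_iff zero_le_mult_iff not_less intro!: antisym)
qed

end

section \<open>Existence of a reduced equilibrium\<close>

theorem corollary26:
  fixes \<mu> :: "real measure" and H :: "real \<Rightarrow> real" and n :: nat
  assumes "admissible_prior \<mu>"
    and "admissible_risk H"
    and "n \<ge> 1"
  shows "\<exists>P X. reduced_equilibrium n \<mu> H P X"
proof -
  obtain F m B where \<mu>: "prob_space \<mu>" "\<mu> = density lborel (\<lambda>l. ennreal (F l * indicator {0..1} l))"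
    and F: "continuous_on UNIV F" "0 < m" "\<And>l. m \<le> F l" "\<And>l. F l \<le> B"
    using admissible_priorE[OF assms(1)] by blast
  obtain H' C \<epsilon> K where H_deriv: "\<And>x. (H has_real_derivative H' x) (at x)"
    and H'_cont: "continuous_on UNIV H'" and H'_mono: "\<And>x y. x \<le> y \<Longrightarrow> H' x \<le> H' y"
    and tangent: "\<And>x y. H x + H' x * (y - x) \<le> H y"
    and H'_lip: "\<And>x y. \<bar>H' x - H' y\<bar> \<le> C * \<bar>x - y\<bar>"
    and H'_bounds: "0 < \<epsilon>" "\<And>x. \<epsilon> \<le> H' x" "\<And>x. H' x \<le> K"
    using admissible_riskE[OF assms(2)] by blast
  have F_pos: "0 < F l" for l using F(2,3) by (rule less_le_trans)
  have H'_pos: "0 < H' x" for x using H'_bounds(1,2) by (rule less_le_trans)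
  have F_meas[measurable]: "F \<in> borel_measurable borel" by (rule borel_measurable_continuous_onI[OF F(1)])
  have \<mu>_carrier: "AE l in \<mu>. l \<in> {0..1}"
    unfolding \<mu>(2) by (subst AE_density) (auto simp: indicator_def)

  define s where "s k = (2 * real k - real n) / sqrt (real n)" for k
  define \<delta> where "\<delta> = 2 / sqrt (real n)"
  define c where "c k = real (card {\<omega> \<in> Omega n. heads n \<omega> = k})" for k
  define h where "h k x l = H' (l * s k - x) * F l" for k x l
  have s_Suc: "s (Suc k) = s k + \<delta>" for k
    by (simp add: s_def \<delta>_def add_divide_distrib[symmetric])
  have Sn: "Sn n \<omega> = s (heads n \<omega>)" if "\<omega> \<in> Omega n" for \<omega>
    using Sn_eq_heads[OF that] by (simp add: s_def)
  have c_pos: "0 < c k" if "k \<le> n" for k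
    using exists_heads[OF that] finite_Omega by (auto simp: c_def card_gt_0_iff)
  interpret cell_weights h "\<epsilon> * m" "K * B" "C * B" c \<delta>
  proof
    fix k x y l
    show "continuous_on UNIV (h k x)"
      unfolding h_def
      by (intro continuous_on_mult F continuous_on_compose2[OF H'_cont _ subset_UNIV]
          continuous_intros)
    show "0 < \<epsilon> * m" using H'_bounds F by simp
    show "\<epsilon> * m \<le> h k x l"
      unfolding h_def using H'_bounds(1,2) F(2,3) by (intro mult_mono) (auto intro: less_imp_le H'_pos)
    show "h k x l \<le> K * B"
      unfolding h_def using H'_bounds(3)[of "l * s k - x"] F(4) F_pos[of l] H'_pos[of "l * s k - x"]
      by (intro mult_mono) auto
    show "h k y l \<le> h k x l" if "x \<le> y"
      unfolding h_def using that by (intro mult_right_mono H'_mono less_imp_le[OF F_pos]) auto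
    have "\<bar>h k x l - h k y l\<bar> = \<bar>H' (l * s k - x) - H' (l * s k - y)\<bar> * F l"
      using F_pos[of l] by (simp add: h_def left_diff_distrib[symmetric] abs_mult)
    also have "\<dots> \<le> (C * \<bar>x - y\<bar>) * B"
      using H'_lip[of "l * s k - x" "l * s k - y"] F(4)[of l] F_pos[of l]
      by (intro mult_mono) (auto simp: abs_minus_commute)
    finally show "\<bar>h k x l - h k y l\<bar> \<le> C * B * \<bar>x - y\<bar>" by (simp add: mult_ac)
    show "0 \<le> c k" "0 \<le> \<delta>" by (simp_all add: c_def \<delta>_def)
  qed
  have "0 < sum c {..n}" using c_pos by (intro sum_pos) auto
  then obtain \<psi> a \<nu> where a: "a 0 = 0" "a (Suc n) = 1" "\<And>k. a k \<le> a (Suc k)"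
    and \<psi>: "\<And>k. \<psi> (Suc k) = \<psi> k + \<delta> * a (Suc k)"
    and cells: "\<And>k. W k (\<psi> k) (a (Suc k)) - W k (\<psi> k) (a k) = \<nu> * c k"
    and mean: "(\<Sum>k\<le>n. c k * \<psi> k) = 0"
    by (rule exists_balanced_cells) blast

  define X where "X = restrict (\<lambda>\<omega>. \<psi> (heads n \<omega>)) (Omega n)"
  define \<rho> where "\<rho> \<omega> l = F l * indicator {a (heads n \<omega>)..a (Suc (heads n \<omega>))} l / c (heads n \<omega>)"
    for \<omega> l
  define P where "P = joint_law n \<rho>"
  have \<rho>_meas: "\<rho> \<omega> \<in> borel_measurable borel" for \<omega>
    unfolding \<rho>_def by measurable
  have \<rho>_nonneg: "0 \<le> \<rho> \<omega> l" for \<omega> l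
    using F_pos[of l] by (simp add: \<rho>_def c_def)
  note joint = \<rho>_meas \<rho>_nonneg

  \<comment> \<open>Summing over the \<open>c k\<close> histories of each class cancels the division by \<open>c k\<close>; neighbouring
    closed cells overlap only at knots, which form a null set.\<close>
  have marginal: "AE l in lborel. (\<Sum>\<omega>\<in>Omega n. \<rho> \<omega> l) = F l * indicator {0..1} l"
  proof -
    have "range a \<in> null_sets lborel" by (intro countable_imp_null_set_lborel) auto
    then have "AE l in lborel. l \<notin> range a" by (rule AE_not_in)
    then show ?thesis
    proof eventually_elim
      fix l assume l: "l \<notin> range a"
      have "(\<Sum>\<omega>\<in>Omega n. \<rho> \<omega> l) = (\<Sum>k\<le>n. c k * (F l * indicator {a k..a (Suc k)} l / c k))"
        unfolding \<rho>_def c_def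
        by (rule sum_by_heads[where g = "\<lambda>k. F l * indicator {a k..a (Suc k)} l
              / real (card {\<omega> \<in> Omega n. heads n \<omega> = k})"])
      also have "\<dots> = (\<Sum>k<Suc n. F l * indicator {a k..a (Suc k)} l)"
        unfolding lessThan_Suc_atMost using c_pos by (intro sum.cong refl) fastforce
      also have "\<dots> = F l * indicator {0..1} l"
        unfolding sum_distrib_left[symmetric] sum_indicator_cells[OF a(3) l] a(1,2) ..
      finally show "(\<Sum>\<omega>\<in>Omega n. \<rho> \<omega> l) = F l * indicator {0..1} l" .
    qed
  qed
  have P: "P \<in> strategies1 n \<mu>"
    unfolding P_def by (rule joint_law_in_strategies1[OF joint \<mu>(2,1) _ marginal]) measurable

  have X_sum: "(\<Sum>\<omega>\<in>Omega n. X \<omega>) = 0"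
    using sum_by_heads[where n = n and g = \<psi>] mean by (simp add: X_def c_def)
  have X: "X \<in> strategies2 n"
    unfolding X_def using X_sum by (intro mean_zero_in_strategies2 assms) (simp add: X_def)

  define \<phi> where "\<phi> l = l * s 0 - \<psi> 0 + (\<Sum>j<n. max 0 (\<delta> * (l - a (Suc j))))" for l
  note env = a(3) \<delta>_nonneg \<psi> s_Suc
  have \<phi>_cont: "continuous_on UNIV \<phi>"
    unfolding \<phi>_def by (intro continuous_intros)
  have best1: "g1 n P' X \<le> g1 n P X" if P': "P' \<in> strategies1 n \<mu>" for P'
  proof -
    have "g1 n P' X \<le> integral\<^sup>L \<mu> \<phi>"
      by (rule g1_compare_envelope(1)[OF P' \<mu>_carrier \<phi>_cont])
         (use line_le_envelope[of a \<delta> \<psi> s, OF env heads_le] in \<open>simp add: X_def Sn \<phi>_def\<close>)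
    also have "integral\<^sup>L \<mu> \<phi> = g1 n P X"
    proof (rule g1_compare_envelope(2)[OF P \<mu>_carrier \<phi>_cont, symmetric])
      show "AE (\<omega>, l) in P. l * Sn n \<omega> - X \<omega> = \<phi> l"
        unfolding P_def joint_law_def
      proof (subst AE_density)
        show "AE x in count_space (Omega n) \<Otimes>\<^sub>M lborel. 0 < ennreal (\<rho> (fst x) (snd x)) \<longrightarrow>
            (case x of (\<omega>, l) \<Rightarrow> l * Sn n \<omega> - X \<omega> = \<phi> l)"
        proof (intro AE_I2, clarify)
          fix \<omega> l
          assume "(\<omega>, l) \<in> space (count_space (Omega n) \<Otimes>\<^sub>M lborel)"
            "0 < ennreal (\<rho> (fst (\<omega>, l)) (snd (\<omega>, l)))"
          then have "\<omega> \<in> Omega n" "l \<in> {a (heads n \<omega>)..a (Suc (heads n \<omega>))}"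
            by (auto simp: space_pair_measure \<rho>_def split: split_indicator_asm)
          then show "l * Sn n \<omega> - X \<omega> = \<phi> l"
            using line_eq_envelope[of a \<delta> \<psi> s, OF env heads_le] by (simp add: X_def Sn \<phi>_def)
        qed
      qed (use measurable_\<rho>[OF joint] in measurable)
    qed
    finally show ?thesis .
  qed

  have best2: "g2 n H P X \<le> g2 n H P X'" if X': "X' \<in> strategies2 n" for X'
  proof (rule g2_minimal_if_equalized[OF H_deriv H'_cont tangent P \<mu>_carrier X_sum])
    show "(\<Sum>\<omega>\<in>Omega n. X' \<omega>) = 0"
      using X' sum_price_fun by (auto simp: strategies2_def)
    fix y :: "(nat \<Rightarrow> real) \<Rightarrow> real"
    let ?G = "\<lambda>x. H' (snd x * Sn n (fst x) - X (fst x)) * y (fst x)"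
    have affine: "continuous_on UNIV (\<lambda>l. l * u - v)" for u v :: real
      by (intro continuous_intros)
    have "integrable P ?G"
      by (rule integrable_strategies1[OF P \<mu>_carrier], simp only: fst_conv snd_conv)
         (intro continuous_on_mult continuous_on_const
           continuous_on_compose2[OF H'_cont affine subset_UNIV])
    then have "integral\<^sup>L P ?G = (\<Sum>\<omega>\<in>Omega n. \<integral>l. \<rho> \<omega> l * ?G (\<omega>, l) \<partial>lborel)"
      unfolding P_def by (rule integral_joint_law[OF joint])
    also have "\<dots> = (\<Sum>\<omega>\<in>Omega n. \<nu> * y \<omega>)"
    proof (intro sum.cong refl)
      fix \<omega> assume \<omega>: "\<omega> \<in> Omega n"
      define k where "k = heads n \<omega>"
      have "(\<integral>l. \<rho> \<omega> l * ?G (\<omega>, l) \<partial>lborel)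
          = (\<integral>l. y \<omega> / c k * (h k (\<psi> k) l * indicator {a k..a (Suc k)} l) \<partial>lborel)"
        using \<omega> by (intro Bochner_Integration.integral_cong refl) (simp add: \<rho>_def h_def X_def Sn k_def)
      also have "\<dots> = y \<omega> / c k * (\<nu> * c k)"
        using h_cont[of k "\<psi> k"]
        by (simp add: integral_FTC_Icc_real[OF a(3) W_deriv] cells continuous_on_eq_continuous_at)
      finally show "(\<integral>l. \<rho> \<omega> l * ?G (\<omega>, l) \<partial>lborel) = \<nu> * y \<omega>"
        using c_pos[OF heads_le, of \<omega>] by (simp add: k_def)
    qed
    finally show "integral\<^sup>L P ?G = \<nu> * (\<Sum>\<omega>\<in>Omega n. y \<omega>)" by (simp add: sum_distrib_left)
  qed
  show ?thesis
    using P X best1 best2 unfolding reduced_equilibrium_def by blast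
qed

end
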